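(* Let $\alpha,\beta$ be non-empty permutations, let $0\le k\le|\alpha|$, and let $\pi=\alpha\,\triangle_k\,\beta$. Then $\mu[1,\pi]=c\cdot\mu[1,\beta]$ for some integer $c$.
   Context: Permutations are ordered by classical pattern containment ($\sigma\le\pi$ if $\pi$ has a subsequence order-isomorphic to $\sigma$), and $\mu[\sigma,\pi]$ is the Möbius function of this poset: $\mu[\sigma,\sigma]=1$, $\mu[\sigma,\pi]=0$ if $\sigma\not\le\pi$, and $\mu[\sigma,\pi]=-\sum_{\sigma\le\lambda<\pi}\mu[\sigma,\lambda]$ if $\sigma<\pi$. Here $1$ is the permutation of length one. For permutations $\alpha$ (length $a$) and $\beta$ (length $b$) and $0\le k\le a$, the wedge permutation $\alpha\,\triangle_k\,\beta$ is the permutation of length $a+b$ $$\alpha_1,\dots,\alpha_k,\;\beta_1+a,\dots,\beta_b+a,\;\alpha_{k+1},\dots,\alpha_a .$$ *)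

theory Defs
  imports "HOL-Library.Sublist" "HOL-Combinatorics.Multiset_Permutations"
begin

text \<open>
  A permutation of length \<open>n\<close> is represented by its one-line notation, a list in which each of
  \<open>1, \<dots>, n\<close> occurs exactly once. The empty permutation \<open>[]\<close> is included; the permutation of
  length one is \<open>[1]\<close>.
\<close>

definition is_perm :: "nat list \<Rightarrow> bool" where
  "is_perm p \<longleftrightarrow> p \<in> permutations_of_set {1..length p}"

definition order_isomorphic :: "nat list \<Rightarrow> nat list \<Rightarrow> bool" where
  "order_isomorphic xs ys \<longleftrightarrow>
     length xs = length ys \<and>
     (\<forall>i < length xs. \<forall>j < length xs. xs ! i < xs ! j \<longleftrightarrow> ys ! i < ys ! j)"

definition pattern_le :: "nat list \<Rightarrow> nat list \<Rightarrow> bool"  (infix \<open>\<preceq>\<close> 50) where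
  "\<sigma> \<preceq> \<pi> \<longleftrightarrow>
     is_perm \<sigma> \<and> is_perm \<pi> \<and> (\<exists>zs. subseq zs \<pi> \<and> order_isomorphic zs \<sigma>)"

definition pattern_less :: "nat list \<Rightarrow> nat list \<Rightarrow> bool"  (infix \<open>\<prec>\<close> 50) where
  "\<sigma> \<prec> \<pi> \<longleftrightarrow> \<sigma> \<preceq> \<pi> \<and> \<sigma> \<noteq> \<pi>"

lemma perm_nth_eq_card:
  assumes "is_perm p" "i < length p"
  shows "p ! i = card {j. j < length p \<and> p ! j \<le> p ! i}"
proof -
  have s: "set p = {1..length p}" and d: "distinct p"
    using assms(1) by (auto simp: is_perm_def permutations_of_set_def)
  have r: "p ! i \<le> length p"
    using s nth_mem[OF assms(2)] by auto
  have "(\<lambda>j. p ! j) ` {j. j < length p \<and> p ! j \<le> p ! i} = {x \<in> set p. x \<le> p ! i}"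
    by (auto simp: set_conv_nth)
  also have "\<dots> = {1..p ! i}"
    using r by (auto simp: s)
  finally have "card ((\<lambda>j. p ! j) ` {j. j < length p \<and> p ! j \<le> p ! i}) = p ! i"
    by simp
  moreover have "inj_on (\<lambda>j. p ! j) {j. j < length p \<and> p ! j \<le> p ! i}"
    using d by (auto simp: inj_on_def nth_eq_iff_index_eq)
  ultimately show ?thesis
    by (simp add: card_image)
qed

lemma order_isomorphic_perm_eq:
  assumes "is_perm p" "is_perm q" "order_isomorphic p q"
  shows "p = q"
proof (rule nth_equalityI)
  show len: "length p = length q"
    using assms(3) by (simp add: order_isomorphic_def)
  fix i assume i: "i < length p"
  have "{j. j < length p \<and> p ! j \<le> p ! i} = {j. j < length q \<and> q ! j \<le> q ! i}"
    using assms(3) i by (auto simp: order_isomorphic_def not_less[symmetric])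
  then show "p ! i = q ! i"
    using perm_nth_eq_card[OF assms(1), of i] perm_nth_eq_card[OF assms(2), of i] i len by metis
qed

lemma pattern_le_length: "\<sigma> \<preceq> \<pi> \<Longrightarrow> length \<sigma> \<le> length \<pi>"
  by (auto simp: pattern_le_def order_isomorphic_def dest: list_emb_length)

lemma pattern_less_length:
  assumes "\<sigma> \<prec> \<pi>"
  shows "length \<sigma> < length \<pi>"
proof (rule ccontr)
  assume "\<not> length \<sigma> < length \<pi>"
  moreover have le: "\<sigma> \<preceq> \<pi>" and ne: "\<sigma> \<noteq> \<pi>"
    using assms by (auto simp: pattern_less_def)
  ultimately have len: "length \<sigma> = length \<pi>"
    using pattern_le_length by fastforce
  obtain zs where zs: "subseq zs \<pi>" "order_isomorphic zs \<sigma>"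
    using le by (auto simp: pattern_le_def)
  then have "zs = \<pi>"
    using len by (intro subseq_same_length) (auto simp: order_isomorphic_def)
  with zs le ne show False
    using order_isomorphic_perm_eq by (auto simp: pattern_le_def)
qed

text \<open>Finiteness of intervals: the sum in the Moebius recursion below never ranges over an
  infinite set, where it would be \<open>0\<close> by convention.\<close>

lemma finite_pattern_below: "finite {\<tau>. \<sigma> \<preceq> \<tau> \<and> \<tau> \<prec> \<pi>}"
proof (rule finite_subset)
  show "{\<tau>. \<sigma> \<preceq> \<tau> \<and> \<tau> \<prec> \<pi>} \<subseteq> (\<Union>n\<le>length \<pi>. permutations_of_set {1..n})"
  proof
    fix l assume "l \<in> {\<tau>. \<sigma> \<preceq> \<tau> \<and> \<tau> \<prec> \<pi>}"
    then show "l \<in> (\<Union>n\<le>length \<pi>. permutations_of_set {1..n})"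
      using pattern_less_length[of l \<pi>]
      by (auto simp: pattern_le_def is_perm_def intro!: bexI[of _ "length l"])
  qed
qed auto

function moebius :: "nat list \<Rightarrow> nat list \<Rightarrow> int" where
  "moebius \<sigma> \<pi> =
     (if \<sigma> = \<pi> then 1
      else if \<not> \<sigma> \<preceq> \<pi> then 0
      else - (\<Sum>\<tau> \<in> {\<tau>. \<sigma> \<preceq> \<tau> \<and> \<tau> \<prec> \<pi>}. moebius \<sigma> \<tau>))"
  by auto
termination
  by (relation "measure (\<lambda>(\<sigma>, \<pi>). length \<pi>)") (auto dest: pattern_less_length)

declare moebius.simps [simp del]

definition wedge :: "nat list \<Rightarrow> nat \<Rightarrow> nat list \<Rightarrow> nat list" where
  "wedge \<alpha> k \<beta> = take k \<alpha> @ map (\<lambda>b. b + length \<alpha>) \<beta> @ drop k \<alpha>"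

end

theory Submission
  imports Defs
begin

text \<open>
  If \<open>\<beta> = [1]\<close>, then \<open>moebius [1] \<beta> = 1\<close> divides everything.
  Otherwise fix \<open>\<alpha>\<close>, \<open>k\<close> and \<open>\<beta>\<close> with \<open>|\<beta>| \<ge> 2\<close>, and put \<open>\<pi> = wedge \<alpha> k \<beta>\<close>. The Moebius values of the
  permutations below \<open>\<pi>\<close> sum to \<open>0\<close>. The idea is to weight this sum by a function
  \<open>f\<close> that discards every \<open>\<rho> \<preceq> \<pi>\<close> except those that still use all of \<open>\<beta>\<close>, and that
  keeps the sum equal to \<open>0\<close>.

  A permutation \<open>\<rho>\<close> lies below \<open>wedge \<alpha> k \<beta>'\<close> exactly when \<open>\<rho> = wedge a j b\<close>, where
  \<open>b \<preceq> \<beta>'\<close> and \<open>a\<close>, with the gap after its first \<open>j\<close> entries, embeds in \<open>\<alpha>\<close> compatibly with the gap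
  at \<open>k\<close> (\<open>pattern_le_wedge_iff\<close>). Here \<open>b\<close> is the pattern of the largest entries of
  \<open>\<rho>\<close>, so the candidates for \<open>b\<close> form a chain in the pattern order
  (\<open>wedge_tops_nested\<close>). Its least member \<open>b\<^sub>\<rho>\<close> decides everything: for \<open>\<beta>' \<preceq> \<beta>\<close>,
  \<open>\<rho> \<preceq> wedge \<alpha> k \<beta>'\<close> holds if and only if \<open>b\<^sub>\<rho> \<preceq> \<beta>'\<close> (\<open>least_top_exists\<close>).

  Choose weights \<open>w\<close> on the permutations below \<open>\<beta>\<close>, the empty one included, such that the
  sum of \<open>w\<close> over the interval from \<open>\<tau>\<close> to \<open>\<beta>\<close> is \<open>1\<close> if \<open>\<tau> = \<beta>\<close> and \<open>0\<close> otherwise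
  (\<open>upper_sum_weights_exist\<close>). Let \<open>f \<rho>\<close> be the sum of \<open>w \<beta>'\<close> over the \<open>\<beta>' \<preceq> \<beta>\<close> with
  \<open>\<rho> \<preceq> wedge \<alpha> k \<beta>'\<close>. Then \<open>f \<rho>\<close> is \<open>1\<close> if \<open>b\<^sub>\<rho> = \<beta>\<close> and \<open>0\<close> otherwise.
  On the other hand, exchanging the order of summation turns \<open>\<Sum>\<rho>. moebius [1] \<rho> * f \<rho>\<close>
  into a combination of the sums of \<open>moebius [1]\<close> over the intervals from \<open>[1]\<close> to
  \<open>wedge \<alpha> k \<beta>'\<close>. These vanish unless \<open>wedge \<alpha> k \<beta>' = [1]\<close>, which for nonempty \<open>\<alpha>\<close>
  forces \<open>\<beta>' = []\<close>; and \<open>w [] = 0\<close>, since the weights of all permutations below \<open>\<beta>\<close> and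
  of the nonempty ones both add up to \<open>0\<close>.

  Hence the Moebius values of the \<open>\<rho> \<preceq> \<pi>\<close> with \<open>b\<^sub>\<rho> = \<beta>\<close> sum to \<open>0\<close>. One of these
  is \<open>\<pi>\<close>, and the others have the form \<open>wedge a j \<beta>\<close> with \<open>a\<close> shorter than \<open>\<alpha>\<close>, so that
  induction on the length of \<open>\<alpha>\<close> shows that \<open>moebius [1] \<beta>\<close> divides \<open>moebius [1] \<pi>\<close>.
\<close>

section \<open>Order isomorphism and pattern containment\<close>

text \<open>
  Regarding the two lists as a set of pairs makes the condition independent of positions, so that
  concatenations and subsequences of pairs can be treated by unions and subsets.
\<close>

lemma order_isomorphic_iff_zip:
  "order_isomorphic xs ys \<longleftrightarrow> length xs = length ys \<and>
     (\<forall>p \<in> set (zip xs ys). \<forall>q \<in> set (zip xs ys). fst p < fst q \<longleftrightarrow> snd p < snd q)"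
  unfolding order_isomorphic_def all_set_conv_all_nth by auto

lemma order_isomorphic_sym: "order_isomorphic xs ys \<Longrightarrow> order_isomorphic ys xs"
  by (auto simp: order_isomorphic_def)

lemma order_isomorphic_trans:
  "order_isomorphic xs ys \<Longrightarrow> order_isomorphic ys zs \<Longrightarrow> order_isomorphic xs zs"
  by (auto simp: order_isomorphic_def)

lemma order_isomorphic_map:
  assumes "\<And>x y. x \<in> set zs \<Longrightarrow> y \<in> set zs \<Longrightarrow> f x < f y \<longleftrightarrow> x < y"
  shows "order_isomorphic zs (map f zs)"
  using assms by (auto simp: order_isomorphic_def)

lemma is_perm_iff: "is_perm p \<longleftrightarrow> distinct p \<and> set p = {1..length p}"
  by (auto simp: is_perm_def permutations_of_set_def)

lemma standardization_exists:
  assumes "distinct zs"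
  obtains \<sigma> where "is_perm \<sigma>" "order_isomorphic zs \<sigma>"
proof -
  define r where "r x = card {y \<in> set zs. y \<le> x}" for x
  have less: "r x < r y" if "x < y" "y \<in> set zs" for x y
  proof -
    have "y \<in> {z \<in> set zs. z \<le> y} - {z \<in> set zs. z \<le> x}" using that by simp
    moreover have "{z \<in> set zs. z \<le> x} \<subseteq> {z \<in> set zs. z \<le> y}" using that by auto
    ultimately show ?thesis unfolding r_def by (intro psubset_card_mono psubsetI) auto
  qed
  have mono: "r x < r y \<longleftrightarrow> x < y" if "x \<in> set zs" "y \<in> set zs" for x y
    using less[of x y] less[of y x] that by (cases x y rule: linorder_cases) auto
  have inj: "inj_on r (set zs)"
    by (rule inj_onI) (metis mono less_irrefl nat_neq_iff)
  have "r ` set zs \<subseteq> {1..length zs}"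
  proof
    fix v assume "v \<in> r ` set zs"
    then obtain x where x: "x \<in> set zs" "v = r x" by auto
    have "0 < r x" unfolding r_def using x by (subst card_gt_0_iff) auto
    moreover have "r x \<le> card (set zs)" unfolding r_def by (intro card_mono) auto
    ultimately show "v \<in> {1..length zs}"
      using x card_length[of zs] by auto
  qed
  then have "r ` set zs = {1..length zs}"
    using inj assms by (intro card_subset_eq) (auto simp: card_image distinct_card)
  then have "is_perm (map r zs)"
    using inj assms by (simp add: is_perm_iff distinct_map)
  moreover have "order_isomorphic zs (map r zs)"
    by (rule order_isomorphic_map) (rule mono)
  ultimately show ?thesis using that by blast
qed

lemma subseq_subset: "subseq xs ys \<Longrightarrow> set xs \<subseteq> set ys"
  by (auto simp: subseq_conv_nths dest: in_set_nthsD)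

lemma subseq_distinct: "subseq xs ys \<Longrightarrow> distinct ys \<Longrightarrow> distinct xs"
  by (auto simp: subseq_conv_nths distinct_nthsI)

text \<open>
  Selecting the same positions in \<open>xs\<close> as in \<open>ys\<close> transports a subsequence along the
  isomorphism. This is what makes pattern containment transitive.
\<close>

lemma order_isomorphic_subseq:
  assumes "order_isomorphic xs ys" "subseq ws ys"
  obtains vs where "subseq vs xs" "order_isomorphic vs ws"
proof -
  let ?ps = "zip xs ys"
  have len: "length xs = length ys"
    using assms by (simp add: order_isomorphic_def)
  obtain N where N: "ws = nths ys N"
    using assms(2) by (auto simp: subseq_conv_nths)
  let ?qs = "nths ?ps N"
  have ws: "ws = map snd ?qs"
    using len N by (simp add: nths_map[symmetric])
  have "subseq (map fst ?qs) xs"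
    using len by (metis map_fst_zip nths_map subseq_conv_nths)
  moreover have "order_isomorphic (map fst ?qs) ws"
  proof -
    have "set ?qs \<subseteq> set ?ps" by (rule set_nths_subset)
    then have "\<forall>p \<in> set ?qs. \<forall>q \<in> set ?qs. fst p < fst q \<longleftrightarrow> snd p < snd q"
      using assms(1) unfolding order_isomorphic_iff_zip by blast
    then show ?thesis
      unfolding ws order_isomorphic_iff_zip by (simp add: zip_map_fst_snd)
  qed
  ultimately show ?thesis using that by blast
qed

lemma pattern_le_trans:
  assumes "\<rho> \<preceq> \<sigma>" "\<sigma> \<preceq> \<tau>"
  shows "\<rho> \<preceq> \<tau>"
proof -
  obtain ws zs where w: "subseq ws \<sigma>" "order_isomorphic ws \<rho>"
      and z: "subseq zs \<tau>" "order_isomorphic zs \<sigma>"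
    using assms by (auto simp: pattern_le_def)
  obtain vs where "subseq vs zs" "order_isomorphic vs ws"
    using order_isomorphic_subseq[OF z(2) w(1)] .
  then show ?thesis
    using assms w z unfolding pattern_le_def
    by (meson order_isomorphic_trans subseq_order.order_trans)
qed

lemma pattern_le_refl: "is_perm p \<Longrightarrow> p \<preceq> p"
  unfolding pattern_le_def by (auto intro!: exI[of _ p] simp: order_isomorphic_def)

lemma empty_pattern_le: "is_perm p \<Longrightarrow> [] \<preceq> p"
  unfolding pattern_le_def by (auto simp: order_isomorphic_def is_perm_iff)

lemma single_pattern_le:
  assumes "is_perm p" "p \<noteq> []"
  shows "[1] \<preceq> p"
  unfolding pattern_le_def using assms
  by (auto simp: order_isomorphic_def is_perm_iff subseq_singleton_left intro!: exI[of _ "[hd p]"])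

lemma pattern_le_same_length:
  "\<sigma> \<preceq> \<tau> \<Longrightarrow> length \<tau> \<le> length \<sigma> \<Longrightarrow> \<sigma> = \<tau>"
  using pattern_less_length[of \<sigma> \<tau>] by (auto simp: pattern_less_def)

section \<open>Patterns contained in a wedge\<close>

lemma length_wedge [simp]: "length (wedge a k b) = length a + length b"
  by (simp add: wedge_def)

lemma is_perm_wedge:
  assumes a: "is_perm a" and b: "is_perm b"
  shows "is_perm (wedge a k b)"
proof -
  have app: "set (take k a) \<union> set (drop k a) = set a"
      "set (take k a) \<inter> set (drop k a) = {}"
    using a set_append[of "take k a" "drop k a"] distinct_append[of "take k a" "drop k a"]
    by (simp_all only: append_take_drop_id is_perm_iff) blast+
  have shift: "set (map (\<lambda>x. x + length a) b) = {length a + 1..length a + length b}"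
    using b image_add_atLeastAtMost[of "length a" 1 "length b"] by (simp add: is_perm_iff add.commute)
  have "set (wedge a k b) = set a \<union> {length a + 1..length a + length b}"
    using app shift by (auto simp: wedge_def)
  then have range: "set (wedge a k b) = {1..length (wedge a k b)}"
    using a by (auto simp: is_perm_iff)
  then have "distinct (wedge a k b)"
    by (intro card_distinct) simp
  then show ?thesis using range by (simp add: is_perm_iff)
qed

text \<open>
  All entries of the middle block exceed all entries around it, both in the list and in the
  wedge. Comparisons across the blocks therefore agree, and those within the blocks agree by
  assumption.
\<close>

lemma order_isomorphic_wedge:
  assumes a: "is_perm a" and b: "is_perm b"
    and oa: "order_isomorphic (xs @ ys) a" and ob: "order_isomorphic bs b"
    and low: "set xs \<union> set ys \<subseteq> {..n}" and pos: "0 \<notin> set bs"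
  shows "order_isomorphic (xs @ map (\<lambda>x. x + n) bs @ ys) (wedge a (length xs) b)"
proof -
  define l r where "l = take (length xs) a" and "r = drop (length xs) a"
  have a_eq: "a = l @ r" by (simp add: l_def r_def)
  have len: "length l = length xs" "length r = length ys" "length b = length bs"
    using oa ob by (auto simp: l_def r_def order_isomorphic_def)
  have wed: "wedge a (length xs) b = l @ map (\<lambda>x. x + length a) b @ r"
    by (simp add: wedge_def l_def r_def)
  have small: "v \<le> length a" if "v \<in> set l \<union> set r" for v
    using a that unfolding is_perm_iff by (auto simp: a_eq)
  have bpos: "0 < v" if "v \<in> set b" for v
    using b that by (auto simp: is_perm_iff)
  define A where "A = set (zip xs l) \<union> set (zip ys r)"
  define B where "B = set (zip bs b)"
  have A: "fst p < fst q \<longleftrightarrow> snd p < snd q" if "p \<in> A" "q \<in> A" for p q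
    using oa len that unfolding order_isomorphic_iff_zip a_eq A_def by simp
  have B: "fst p < fst q \<longleftrightarrow> snd p < snd q" if "p \<in> B" "q \<in> B" for p q
    using ob that unfolding order_isomorphic_iff_zip B_def by simp
  have AB: "fst p < fst q + n \<and> snd p < snd q + length a" if "p \<in> A" "q \<in> B" for p q
  proof -
    have "fst p \<in> set xs \<union> set ys" "snd p \<in> set l \<union> set r"
      using that(1) unfolding A_def by (cases p; auto dest: set_zip_leftD set_zip_rightD)+
    then have p: "fst p \<le> n" "snd p \<le> length a" using low small by blast+
    have "(fst q, snd q) \<in> set (zip bs b)" using that(2) by (simp add: B_def)
    then have q: "fst q \<in> set bs" "snd q \<in> set b"
      by (rule set_zip_leftD, rule set_zip_rightD)
    have "fst q \<noteq> 0" using pos q(1) by metis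
    moreover have "0 < snd q" using q(2) by (rule bpos)
    ultimately show ?thesis using p by linarith
  qed
  let ?shift = "map_prod (\<lambda>x. x + n) (\<lambda>y. y + length a)"
  have zip_eq: "set (zip (xs @ map (\<lambda>x. x + n) bs @ ys) (l @ map (\<lambda>x. x + length a) b @ r))
      = A \<union> ?shift ` B"
    using len by (simp add: A_def B_def zip_map_map map_prod_def Un_ac)
  have "fst p < fst q \<longleftrightarrow> snd p < snd q" if "p \<in> A \<union> ?shift ` B" "q \<in> A \<union> ?shift ` B" for p q
    using that
  proof (elim UnE imageE)
    fix p' q' assume "p = ?shift p'" "p' \<in> B" "q = ?shift q'" "q' \<in> B"
    then show ?thesis using B[of p' q'] by simp
  next
    fix p' assume "p = ?shift p'" "p' \<in> B" "q \<in> A"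
    then show ?thesis using AB[of q p'] by simp
  next
    fix q' assume "p \<in> A" "q = ?shift q'" "q' \<in> B"
    then show ?thesis using AB[of p q'] by simp
  qed (rule A)
  then show ?thesis
    unfolding order_isomorphic_iff_zip wed zip_eq using len by simp
qed

text \<open>
  Containment of permutations with a marked gap, the gap being given by the number of entries to its
  left: entries before the gap must come from entries before the gap, and likewise after it. It
  describes which lower parts can occur in a pattern of a wedge.
\<close>

definition gap_pattern_le :: "nat list \<Rightarrow> nat \<Rightarrow> nat list \<Rightarrow> nat \<Rightarrow> bool" where
  "gap_pattern_le a j \<alpha> k \<longleftrightarrow> is_perm a \<and>
     (\<exists>xs ys. subseq xs (take k \<alpha>) \<and> subseq ys (drop k \<alpha>) \<and> length xs = j \<and>
        order_isomorphic (xs @ ys) a)"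

text \<open>
  A subsequence of a wedge splits into a piece of the middle block and two pieces of the lower
  part. Standardizing the middle piece and the joined outer pieces separately exhibits its
  pattern as a wedge again.
\<close>

lemma pattern_le_wedge_iff:
  assumes \<alpha>: "is_perm \<alpha>" and \<beta>: "is_perm \<beta>"
  shows "\<rho> \<preceq> wedge \<alpha> k \<beta> \<longleftrightarrow>
    (\<exists>a j b. gap_pattern_le a j \<alpha> k \<and> b \<preceq> \<beta> \<and> \<rho> = wedge a j b)"
  (is "?L \<longleftrightarrow> ?R")
proof -
  let ?n = "length \<alpha>"
  have low: "set xs \<union> set ys \<subseteq> {..?n}" if "subseq xs (take k \<alpha>)" "subseq ys (drop k \<alpha>)" for xs ys
  proof -
    have "set xs \<union> set ys \<subseteq> set \<alpha>"
      using that[THEN subseq_subset] set_take_subset[of k \<alpha>] set_drop_subset[of k \<alpha>] by blast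
    then show ?thesis using \<alpha> by (auto simp: is_perm_iff)
  qed
  have pos: "0 \<notin> set bs" if "subseq bs \<beta>" for bs
    using subseq_subset[OF that] \<beta> by (auto simp: is_perm_iff)
  show ?thesis
  proof
    assume ?L
    then obtain zs where zs: "subseq zs (wedge \<alpha> k \<beta>)" "order_isomorphic zs \<rho>" and p: "is_perm \<rho>"
      by (auto simp: pattern_le_def)
    then obtain xs ms ys where split: "zs = xs @ ms @ ys" and xs: "subseq xs (take k \<alpha>)"
        and ms: "subseq ms (map (\<lambda>x. x + ?n) \<beta>)" and ys: "subseq ys (drop k \<alpha>)"
      by (auto simp: wedge_def subseq_append_iff)
    obtain bs where bs: "subseq bs \<beta>" "ms = map (\<lambda>x. x + ?n) bs"
      using ms by (auto simp: subseq_conv_nths nths_map)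
    have "distinct (xs @ ys)"
      using subseq_distinct[OF list_emb_append_mono[OF xs ys]] \<alpha> by (simp add: is_perm_iff)
    then obtain a where a: "is_perm a" "order_isomorphic (xs @ ys) a"
      by (rule standardization_exists)
    have "distinct bs"
      using subseq_distinct[OF bs(1)] \<beta> by (simp add: is_perm_iff)
    then obtain b where b: "is_perm b" "order_isomorphic bs b"
      by (rule standardization_exists)
    have "order_isomorphic zs (wedge a (length xs) b)"
      unfolding split bs(2) using a b low[OF xs ys] pos[OF bs(1)]
      by (intro order_isomorphic_wedge) auto
    then have "\<rho> = wedge a (length xs) b"
      using zs(2) p is_perm_wedge[OF a(1) b(1)]
      by (meson order_isomorphic_perm_eq order_isomorphic_sym order_isomorphic_trans)
    moreover have "gap_pattern_le a (length xs) \<alpha> k"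
      unfolding gap_pattern_le_def using a xs ys by blast
    moreover have "b \<preceq> \<beta>"
      unfolding pattern_le_def using b \<beta> bs by blast
    ultimately show ?R by blast
  next
    assume ?R
    then obtain a b xs ys bs where a: "is_perm a" "order_isomorphic (xs @ ys) a"
        and xs: "subseq xs (take k \<alpha>)" and ys: "subseq ys (drop k \<alpha>)"
        and b: "is_perm b" "order_isomorphic bs b" and bs: "subseq bs \<beta>"
        and \<rho>: "\<rho> = wedge a (length xs) b"
      by (auto simp: gap_pattern_le_def pattern_le_def)
    have "subseq (xs @ map (\<lambda>x. x + ?n) bs @ ys) (wedge \<alpha> k \<beta>)"
      unfolding wedge_def using xs ys bs by (intro list_emb_append_mono subseq_map)
    moreover have "order_isomorphic (xs @ map (\<lambda>x. x + ?n) bs @ ys) \<rho>"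
      unfolding \<rho> using a b low[OF xs ys] pos[OF bs] by (intro order_isomorphic_wedge) auto
    ultimately show ?L
      unfolding pattern_le_def using is_perm_wedge \<alpha> \<beta> a b \<rho> by blast
  qed
qed

lemma filter_wedge_top:
  assumes "is_perm a" "is_perm b"
  shows "filter (\<lambda>v. length a < v) (wedge a j b) = map (\<lambda>x. x + length a) b"
proof -
  have "\<not> length a < v" if "v \<in> set (take j a) \<union> set (drop j a)" for v
    using assms(1) that in_set_takeD[of v j a] in_set_dropD[of v j a] by (auto simp: is_perm_iff)
  moreover have "0 < v" if "v \<in> set b" for v
    using assms(2) that by (auto simp: is_perm_iff)
  ultimately show ?thesis
    by (auto simp: wedge_def filter_empty_conv filter_map intro!: filter_True)
qed

text \<open>
  The top block of a wedge consists of its largest entries, whose number is the length of the block.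
  So of two top blocks of the same permutation, the shorter one is cut out of the longer one by
  raising the threshold.
\<close>

lemma wedge_tops_nested:
  assumes "is_perm a" "is_perm b" "is_perm a'" "is_perm b'"
    and eq: "wedge a j b = wedge a' j' b'" and len: "length b \<le> length b'"
  shows "b \<preceq> b'"
proof -
  let ?n = "length a" and ?n' = "length a'"
  have "?n + length b = ?n' + length b'"
    using arg_cong[OF eq, of length] by simp
  then have n: "?n' \<le> ?n" using len by simp
  let ?zs = "filter (\<lambda>x. ?n < x + ?n') b'"
  have "map (\<lambda>x. x + ?n) b = filter (\<lambda>v. ?n < v) (filter (\<lambda>v. ?n' < v) (wedge a' j' b'))"
    using n by (simp add: filter_wedge_top[OF assms(1,2), of j, symmetric] eq)
      (metis (no_types, lifting) order.strict_trans1)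
  also have "\<dots> = map (\<lambda>x. x + ?n') ?zs"
    by (simp add: filter_wedge_top[OF assms(3,4)] filter_map comp_def)
  finally have e: "map (\<lambda>x. x + ?n) b = map (\<lambda>x. x + ?n') ?zs" .
  have "order_isomorphic ?zs (map (\<lambda>x. x + ?n') ?zs)" "order_isomorphic b (map (\<lambda>x. x + ?n) b)"
    by (rule order_isomorphic_map; simp)+
  then have "order_isomorphic ?zs b"
    using e order_isomorphic_sym order_isomorphic_trans by metis
  then show ?thesis
    unfolding pattern_le_def using assms subseq_filter_left by blast
qed

text \<open>
  The \<open>\<beta>' \<preceq> \<beta>\<close> for which \<open>\<rho> \<preceq> wedge \<alpha> k \<beta>'\<close> form a principal upper set, generated by the
  shortest possible top block of \<open>\<rho>\<close>: all other top blocks contain it. When this block is empty,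
  the pair \<open>(a, j)\<close> need not be unique, but the generator is still the empty permutation.
\<close>

lemma least_top_exists:
  assumes \<alpha>: "is_perm \<alpha>" and \<beta>: "is_perm \<beta>" and le: "\<rho> \<preceq> wedge \<alpha> k \<beta>"
  obtains a j b where "gap_pattern_le a j \<alpha> k" "b \<preceq> \<beta>" "\<rho> = wedge a j b"
    "\<And>\<beta>'. \<beta>' \<preceq> \<beta> \<Longrightarrow> \<rho> \<preceq> wedge \<alpha> k \<beta>' \<longleftrightarrow> b \<preceq> \<beta>'"
proof -
  let ?T = "\<lambda>b. is_perm b \<and> (\<exists>a j. gap_pattern_le a j \<alpha> k \<and> \<rho> = wedge a j b)"
  have ex: "\<exists>b. b \<preceq> \<beta> \<and> ?T b"
    using le unfolding pattern_le_wedge_iff[OF \<alpha> \<beta>] unfolding pattern_le_def by blast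
  then obtain b where b: "?T b" and least: "\<And>b'. ?T b' \<Longrightarrow> length b \<le> length b'"
    using ex_has_least_nat[of ?T _ length] by blast
  then obtain a j where aj: "gap_pattern_le a j \<alpha> k" "\<rho> = wedge a j b" by blast
  have below: "b \<preceq> b'" if "?T b'" for b'
    using that b aj least[OF that] wedge_tops_nested by (metis gap_pattern_le_def)
  have iff: "\<rho> \<preceq> wedge \<alpha> k \<beta>' \<longleftrightarrow> b \<preceq> \<beta>'" if "\<beta>' \<preceq> \<beta>" for \<beta>'
  proof -
    have p: "is_perm \<beta>'" using that by (simp add: pattern_le_def)
    show ?thesis
    proof
      assume "\<rho> \<preceq> wedge \<alpha> k \<beta>'"
      then obtain b' where "b' \<preceq> \<beta>'" "?T b'"
        unfolding pattern_le_wedge_iff[OF \<alpha> p] unfolding pattern_le_def by blast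
      then show "b \<preceq> \<beta>'" using below pattern_le_trans by blast
    next
      assume "b \<preceq> \<beta>'"
      then show "\<rho> \<preceq> wedge \<alpha> k \<beta>'"
        unfolding pattern_le_wedge_iff[OF \<alpha> p] using aj by blast
    qed
  qed
  have "b \<preceq> \<beta>" using iff[OF pattern_le_refl[OF \<beta>]] le by blast
  then show ?thesis using that aj iff by blast
qed

lemma wedge_mono:
  assumes "is_perm \<alpha>" "\<beta>' \<preceq> \<beta>"
  shows "wedge \<alpha> k \<beta>' \<preceq> wedge \<alpha> k \<beta>"
proof -
  have p: "is_perm \<beta>'" "is_perm \<beta>" using assms by (auto simp: pattern_le_def)
  have "wedge \<alpha> k \<beta>' \<preceq> wedge \<alpha> k \<beta>'"
    using assms p by (intro pattern_le_refl is_perm_wedge)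
  then show ?thesis
    unfolding pattern_le_wedge_iff[OF assms(1) p(1)] pattern_le_wedge_iff[OF assms(1) p(2)]
    using assms(2) pattern_le_trans by blast
qed

section \<open>Sums over intervals\<close>

lemma finite_below: "finite {\<tau>. \<sigma> \<preceq> \<tau> \<and> \<tau> \<preceq> \<pi>}"
proof (rule finite_subset)
  show "{\<tau>. \<sigma> \<preceq> \<tau> \<and> \<tau> \<preceq> \<pi>} \<subseteq> insert \<pi> {\<tau>. \<sigma> \<preceq> \<tau> \<and> \<tau> \<prec> \<pi>}"
    by (auto simp: pattern_less_def)
qed (simp add: finite_pattern_below)

lemma sum_moebius_interval:
  assumes "\<sigma> \<preceq> \<pi>"
  shows "(\<Sum>\<tau> | \<sigma> \<preceq> \<tau> \<and> \<tau> \<preceq> \<pi>. moebius \<sigma> \<tau>) = (if \<sigma> = \<pi> then 1 else 0)"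
proof -
  have eq: "{\<tau>. \<sigma> \<preceq> \<tau> \<and> \<tau> \<preceq> \<pi>} = insert \<pi> {\<tau>. \<sigma> \<preceq> \<tau> \<and> \<tau> \<prec> \<pi>}"
    using assms pattern_le_refl[of \<pi>] unfolding pattern_less_def
    by (auto simp: pattern_le_def[of \<sigma> \<pi>])
  have none: "{\<tau>. \<pi> \<preceq> \<tau> \<and> \<tau> \<prec> \<pi>} = {}"
    using pattern_less_length pattern_le_length by (metis (mono_tags, lifting) Collect_empty_eq leD)
  have "\<pi> \<notin> {\<tau>. \<sigma> \<preceq> \<tau> \<and> \<tau> \<prec> \<pi>}" by (simp add: pattern_less_def)
  then show ?thesis
    unfolding eq using assms finite_pattern_below[of \<sigma> \<pi>] moebius.simps[of \<sigma> \<pi>]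
    by (cases "\<sigma> = \<pi>") (simp_all add: none)
qed

text \<open>
  The system of equations is triangular with ones on the diagonal: if permutations are added
  in order of decreasing length, the weight of a new one is determined by the earlier weights
  and does not affect the earlier equations.

  If \<open>S\<close> consists of the permutations below \<open>\<beta>\<close> and \<open>g\<close> is the indicator of \<open>\<beta>\<close>, then the
  weight of \<open>\<sigma>\<close> is the Moebius function from \<open>\<sigma>\<close> to \<open>\<beta>\<close>. Solving the system directly gives the summation over lower
  endpoints, whereas \<open>moebius\<close> is defined by summation over upper endpoints.
\<close>

lemma upper_sum_weights_exist:
  fixes g :: "nat list \<Rightarrow> int"
  assumes "finite S" "\<forall>\<tau>\<in>S. is_perm \<tau>"
  shows "\<exists>w. \<forall>\<tau>\<in>S. (\<Sum>\<sigma> | \<sigma> \<in> S \<and> \<tau> \<preceq> \<sigma>. w \<sigma>) = g \<tau>"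
  using assms
proof (induction S rule: finite_ranking_induct[where f = "\<lambda>\<tau>. - int (length \<tau>)"])
  case empty
  then show ?case by simp
next
  case (insert x S)
  show ?case
  proof (cases "x \<in> S")
    case True
    then show ?thesis using insert by (simp add: insert_absorb)
  next
    case False
    obtain w where w: "\<forall>\<tau>\<in>S. (\<Sum>\<sigma> | \<sigma> \<in> S \<and> \<tau> \<preceq> \<sigma>. w \<sigma>) = g \<tau>"
      using insert by auto
    let ?w = "w(x := g x - (\<Sum>\<sigma> | \<sigma> \<in> S \<and> x \<preceq> \<sigma>. w \<sigma>))"
    have old: "(\<Sum>\<sigma> | \<sigma> \<in> S \<and> \<tau> \<preceq> \<sigma>. ?w \<sigma>) = (\<Sum>\<sigma> | \<sigma> \<in> S \<and> \<tau> \<preceq> \<sigma>. w \<sigma>)" for \<tau>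
      using False by (intro sum.cong) auto
    have "(\<Sum>\<sigma> | \<sigma> \<in> insert x S \<and> \<tau> \<preceq> \<sigma>. ?w \<sigma>) = g \<tau>" if \<tau>: "\<tau> \<in> insert x S" for \<tau>
    proof (cases "\<tau> = x")
      case True
      have "{\<sigma>. \<sigma> \<in> insert x S \<and> x \<preceq> \<sigma>} = insert x {\<sigma>. \<sigma> \<in> S \<and> x \<preceq> \<sigma>}"
        using insert.prems pattern_le_refl by auto
      then show ?thesis
        using True False insert.hyps(1) old[of x] by simp
    next
      case neq: False
      have "\<not> \<tau> \<preceq> x"
        using neq \<tau> insert.hyps(2)[of \<tau>] pattern_le_same_length[of \<tau> x] by auto
      then have "{\<sigma>. \<sigma> \<in> insert x S \<and> \<tau> \<preceq> \<sigma>} = {\<sigma>. \<sigma> \<in> S \<and> \<tau> \<preceq> \<sigma>}" by auto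
      then show ?thesis using w \<tau> neq old by auto
    qed
    then show ?thesis by blast
  qed
qed

section \<open>Divisibility\<close>

lemma moebius_dvd_moebius_wedge:
  assumes "is_perm \<alpha>" "is_perm \<beta>" "2 \<le> length \<beta>"
  shows "moebius [1] \<beta> dvd moebius [1] (wedge \<alpha> k \<beta>)"
  using assms(1)
proof (induction "length \<alpha>" arbitrary: \<alpha> k rule: less_induct)
  case less
  note \<alpha> = less.prems and \<beta> = assms(2)
  show ?case
  proof (cases "\<alpha> = []")
    case True
    then show ?thesis by (simp add: wedge_def)
  next
    case False
    define \<pi> where "\<pi> = wedge \<alpha> k \<beta>"
    define S where "S = {\<beta>'. \<beta>' \<preceq> \<beta>}"
    define D where "D = {\<rho>. [1] \<preceq> \<rho> \<and> \<rho> \<preceq> \<pi>}"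
    have S_alt: "S = {\<beta>'. [] \<preceq> \<beta>' \<and> \<beta>' \<preceq> \<beta>}"
      unfolding S_def using empty_pattern_le by (auto simp: pattern_le_def)
    have finS: "finite S" unfolding S_alt by (rule finite_below)
    have finD: "finite D" unfolding D_def by (rule finite_below)
    have permS: "\<forall>\<tau>\<in>S. is_perm \<tau>" by (auto simp: S_def pattern_le_def)
    obtain w :: "nat list \<Rightarrow> int" where
      w: "\<And>\<tau>. \<tau> \<in> S \<Longrightarrow> (\<Sum>\<sigma> | \<sigma> \<in> S \<and> \<tau> \<preceq> \<sigma>. w \<sigma>) = (if \<tau> = \<beta> then 1 else 0)"
      using upper_sum_weights_exist[OF finS permS, of "\<lambda>\<tau>. if \<tau> = \<beta> then 1 else 0"] by blast
    have empty_S: "[] \<in> S" using \<beta> by (simp add: S_def empty_pattern_le)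
    have one_S: "[1] \<in> S" using single_pattern_le[OF \<beta>] assms(3) unfolding S_def by fastforce
    \<comment> \<open>The equations at \<open>[]\<close> and at \<open>[1]\<close> both have right-hand side \<open>0\<close>, because \<open>|\<beta>| \<ge> 2\<close>,
      and \<open>[]\<close> is the only permutation below \<open>\<beta>\<close> that does not contain \<open>[1]\<close>.\<close>
    have w_empty: "w [] = 0"
    proof -
      have "{\<sigma>. \<sigma> \<in> S \<and> [] \<preceq> \<sigma>} = insert [] {\<sigma>. \<sigma> \<in> S \<and> [1] \<preceq> \<sigma>}"
        using permS empty_S empty_pattern_le single_pattern_le by blast
      moreover have "[] \<notin> {\<sigma>. \<sigma> \<in> S \<and> [1] \<preceq> \<sigma>}"
        using pattern_le_length[of "[1]" "[]"] by auto
      ultimately have "(\<Sum>\<sigma> | \<sigma> \<in> S \<and> [] \<preceq> \<sigma>. w \<sigma>) = w [] + (\<Sum>\<sigma> | \<sigma> \<in> S \<and> [1] \<preceq> \<sigma>. w \<sigma>)"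
        using finS by simp
      moreover have "\<beta> \<noteq> []" "\<beta> \<noteq> [1]" using assms(3) by auto
      ultimately show ?thesis
        using w[OF empty_S] w[OF one_S] by simp
    qed
    \<comment> \<open>On \<open>D\<close>, \<open>f\<close> is the indicator of the permutations whose least top block is \<open>\<beta>\<close>.\<close>
    define f where "f \<rho> = (\<Sum>\<sigma> | \<sigma> \<in> S \<and> \<rho> \<preceq> wedge \<alpha> k \<sigma>. w \<sigma>)" for \<rho>
    have total: "(\<Sum>\<rho>\<in>D. moebius [1] \<rho> * f \<rho>) = 0"
    proof -
      have "(\<Sum>\<rho>\<in>D. moebius [1] \<rho> * f \<rho>) =
          (\<Sum>\<rho>\<in>D. \<Sum>\<sigma> | \<sigma> \<in> S \<and> \<rho> \<preceq> wedge \<alpha> k \<sigma>. moebius [1] \<rho> * w \<sigma>)"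
        by (simp add: f_def sum_distrib_left)
      also have "\<dots> = (\<Sum>\<sigma>\<in>S. \<Sum>\<rho> | \<rho> \<in> D \<and> \<rho> \<preceq> wedge \<alpha> k \<sigma>. moebius [1] \<rho> * w \<sigma>)"
        using finS finD by (rule sum.swap_restrict[symmetric])
      also have "\<dots> = (\<Sum>\<sigma>\<in>S. 0)"
      proof (rule sum.cong[OF refl])
        fix \<sigma> assume \<sigma>: "\<sigma> \<in> S"
        have p: "is_perm (wedge \<alpha> k \<sigma>)" using \<sigma> permS \<alpha> is_perm_wedge by blast
        have ne: "wedge \<alpha> k \<sigma> \<noteq> []" using False length_wedge[of \<alpha> k \<sigma>] by fastforce
        have "wedge \<alpha> k \<sigma> \<preceq> \<pi>"
          using \<sigma> \<alpha> wedge_mono unfolding S_def \<pi>_def by blast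
        then have "{\<rho>. \<rho> \<in> D \<and> \<rho> \<preceq> wedge \<alpha> k \<sigma>} = {\<rho>. [1] \<preceq> \<rho> \<and> \<rho> \<preceq> wedge \<alpha> k \<sigma>}"
          unfolding D_def using pattern_le_trans by blast
        then have "(\<Sum>\<rho> | \<rho> \<in> D \<and> \<rho> \<preceq> wedge \<alpha> k \<sigma>. moebius [1] \<rho> * w \<sigma>)
            = (if [1] = wedge \<alpha> k \<sigma> then 1 else 0) * w \<sigma>"
          using sum_moebius_interval[OF single_pattern_le[OF p ne]]
          by (simp add: sum_distrib_right[symmetric])
        moreover have "\<sigma> = []" if "[1] = wedge \<alpha> k \<sigma>"
          using arg_cong[OF that, of length] False by (cases \<alpha>) auto
        ultimately show "(\<Sum>\<rho> | \<rho> \<in> D \<and> \<rho> \<preceq> wedge \<alpha> k \<sigma>. moebius [1] \<rho> * w \<sigma>) = 0"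
          using w_empty by auto
      qed
      finally show ?thesis by simp
    qed
    have \<beta>S: "\<beta> \<in> S" using \<beta> by (simp add: S_def pattern_le_refl)
    have "is_perm \<pi>" "\<pi> \<noteq> []"
      using \<alpha> \<beta> False is_perm_wedge[of \<alpha> \<beta> k] length_wedge[of \<alpha> k \<beta>] by (auto simp: \<pi>_def wedge_def)
    then have \<pi>D: "\<pi> \<in> D"
      unfolding D_def using single_pattern_le pattern_le_refl by blast
    \<comment> \<open>By length, \<open>\<pi>\<close> is contained in no \<open>wedge \<alpha> k \<sigma>\<close> with \<open>\<sigma> \<prec> \<beta>\<close>.\<close>
    have f_\<pi>: "f \<pi> = 1"
    proof -
      have "\<sigma> = \<beta>" if "\<sigma> \<in> S" "\<pi> \<preceq> wedge \<alpha> k \<sigma>" for \<sigma>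
        using that pattern_le_length[of \<pi> "wedge \<alpha> k \<sigma>"] pattern_le_same_length[of \<sigma> \<beta>]
        by (auto simp: S_def \<pi>_def)
      moreover have "\<beta> \<preceq> \<sigma> \<longleftrightarrow> \<sigma> = \<beta>" if "\<sigma> \<in> S" for \<sigma>
        using that pattern_le_length pattern_le_same_length \<beta> pattern_le_refl
        unfolding S_def by (metis mem_Collect_eq)
      ultimately have "{\<sigma>. \<sigma> \<in> S \<and> \<pi> \<preceq> wedge \<alpha> k \<sigma>} = {\<beta>}" "{\<sigma>. \<sigma> \<in> S \<and> \<beta> \<preceq> \<sigma>} = {\<beta>}"
        using \<pi>D \<beta>S by (auto simp: \<pi>_def D_def)
      then show ?thesis using w[OF \<beta>S] by (simp add: f_def)
    qed
    have "moebius [1] \<beta> dvd moebius [1] \<rho> * f \<rho>" if \<rho>: "\<rho> \<in> D - {\<pi>}" for \<rho>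
    proof -
      have "\<rho> \<preceq> wedge \<alpha> k \<beta>" using \<rho> by (simp add: D_def \<pi>_def)
      then obtain a j b where aj: "gap_pattern_le a j \<alpha> k" and b: "b \<preceq> \<beta>" and eq: "\<rho> = wedge a j b"
          and iff: "\<And>\<beta>'. \<beta>' \<preceq> \<beta> \<Longrightarrow> \<rho> \<preceq> wedge \<alpha> k \<beta>' \<longleftrightarrow> b \<preceq> \<beta>'"
        using least_top_exists[OF \<alpha> \<beta>] by blast
      have "{\<sigma>. \<sigma> \<in> S \<and> \<rho> \<preceq> wedge \<alpha> k \<sigma>} = {\<sigma>. \<sigma> \<in> S \<and> b \<preceq> \<sigma>}"
        using iff by (auto simp: S_def)
      then have f: "f \<rho> = (if b = \<beta> then 1 else 0)"
        using w[of b] b by (simp add: f_def S_def)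
      show ?thesis
      proof (cases "b = \<beta>")
        case True
        have "length \<rho> < length \<pi>"
          using \<rho> pattern_less_length by (auto simp: D_def pattern_less_def)
        then have "length a < length \<alpha>"
          by (simp add: eq True \<pi>_def)
        then show ?thesis
          using less.hyps aj by (simp add: eq True gap_pattern_le_def)
      qed (simp add: f)
    qed
    then have "moebius [1] \<beta> dvd (\<Sum>\<rho>\<in>D - {\<pi>}. moebius [1] \<rho> * f \<rho>)"
      by (rule dvd_sum)
    moreover have "moebius [1] \<pi> = - (\<Sum>\<rho>\<in>D - {\<pi>}. moebius [1] \<rho> * f \<rho>)"
      using total sum.remove[OF finD \<pi>D, of "\<lambda>\<rho>. moebius [1] \<rho> * f \<rho>"] f_\<pi> by simp
    ultimately show ?thesis by (simp add: \<pi>_def)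
  qed
qed

theorem theorem73:
  fixes \<alpha> \<beta> \<pi> :: "nat list" and k :: nat
  assumes "is_perm \<alpha>" and "\<alpha> \<noteq> []"
    and "is_perm \<beta>" and "\<beta> \<noteq> []"
    and "k \<le> length \<alpha>"
    and "\<pi> = wedge \<alpha> k \<beta>"
  shows "\<exists>c :: int. moebius [1] \<pi> = c * moebius [1] \<beta>"
proof (cases "2 \<le> length \<beta>")
  case True
  then have "moebius [1] \<beta> dvd moebius [1] \<pi>"
    using moebius_dvd_moebius_wedge assms by simp
  then show ?thesis by (auto simp: dvd_def mult.commute)
next
  case False
  \<comment> \<open>For \<open>\<beta> = [1]\<close> the quotient is \<open>moebius [1] \<pi>\<close> itself.\<close>
  have "[1] \<preceq> \<beta>" using assms single_pattern_le by blast
  then have "\<beta> = [1]" using False pattern_le_same_length[of "[1]" \<beta>] by simp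
  moreover have "moebius [1] [1] = 1" by (subst moebius.simps) simp
  ultimately show ?thesis by simp
qed

end
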